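(* Let $n \geq 1$ and let $d_0 \geq d_1 \geq \cdots \geq d_n \geq 2$ be integers. Let $K$ be an infinite field of characteristic two, let $R = K[x_0, \ldots, x_n]$, and let $I = (x_0^{d_0}, \ldots, x_n^{d_n}) \subset R$. Then $R/I$ has the strong Lefschetz property if and only if $n = 1$ and either (i) $d_0$ is odd and $d_1 = 2$, or (ii) $d_0 = 4k+2$ for some $k \in \mathbb{N}$ and $d_1 = 3$.
   Context: $R$ is standard graded and $[A]_d$ denotes the degree $d$ component of a graded algebra $A$. An artinian standard graded $K$-algebra $A = R/I$ has the strong Lefschetz property if there exists a linear form $\ell \in A$ such that for all integers $d$ and all $k \geq 1$ the multiplication map $\times \ell^k : [A]_d \rightarrow [A]_{d+k}$ has maximal rank (i.e. is injective or surjective). $\mathbb{N}$ denotes the positive integers. *)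

theory Defs
  imports
    "HOL-Computational_Algebra.Computational_Algebra"
    "HOL-Library.Poly_Mapping"
    "HOL-Algebra.QuotRing"
begin

text \<open>
  Monomials are finitely supported exponent functions \<open>nat \<Rightarrow>\<^sub>0 nat\<close>, and polynomials
  in the variables \<open>x\<^sub>0, x\<^sub>1, \<dots>\<close> are finitely supported coefficient functions on
  monomials; the multiplication of \<open>poly_mapping\<close> is the usual convolution.
\<close>

type_synonym monomial = "nat \<Rightarrow>\<^sub>0 nat"
type_synonym 'k mpoly = "monomial \<Rightarrow>\<^sub>0 'k"

definition mvar :: "nat \<Rightarrow> 'k::field mpoly" where
  "mvar i = Poly_Mapping.single (Poly_Mapping.single i 1) 1"

definition mdeg :: "monomial \<Rightarrow> nat" where
  "mdeg m = (\<Sum>i\<in>Poly_Mapping.keys m. Poly_Mapping.lookup m i)"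

text \<open>\<open>mpoly_ring n\<close> is \<open>K[x\<^sub>0, \<dots>, x\<^sub>n]\<close>, in \<open>n + 1\<close> variables.\<close>

definition mpoly_ring :: "nat \<Rightarrow> 'k::field mpoly ring" where
  "mpoly_ring n =
     \<lparr>carrier = {p. \<forall>m\<in>Poly_Mapping.keys p. Poly_Mapping.keys m \<subseteq> {..n}},
      mult = (*), one = 1, zero = 0, add = (+)\<rparr>"

lemma cring_mpoly_ring: "cring (mpoly_ring n :: 'k::field mpoly ring)"
proof -
  let ?R = "mpoly_ring n :: 'k mpoly ring"
  have add: "p + q \<in> carrier ?R" if "p \<in> carrier ?R" "q \<in> carrier ?R" for p q
    using that Poly_Mapping.keys_add[of p q] by (auto simp: mpoly_ring_def)
  have mult: "p * q \<in> carrier ?R" if p: "p \<in> carrier ?R" and q: "q \<in> carrier ?R" for p q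
  proof -
    have "Poly_Mapping.keys m \<subseteq> {..n}" if m_in: "m \<in> Poly_Mapping.keys (p * q)" for m
    proof -
      obtain a b where m: "m = a + b" "a \<in> Poly_Mapping.keys p" "b \<in> Poly_Mapping.keys q"
        using m_in Poly_Mapping.keys_mult[of p q] by blast
      then show ?thesis
        using p q Poly_Mapping.keys_add[of a b] unfolding mpoly_ring_def by fastforce
    qed
    then show ?thesis by (auto simp: mpoly_ring_def)
  qed
  have zero: "0 \<in> carrier ?R" and one: "1 \<in> carrier ?R"
    by (auto simp: mpoly_ring_def simp flip: single_one)
  have neg: "- p \<in> carrier ?R" if "p \<in> carrier ?R" for p
    using that by (auto simp: mpoly_ring_def in_keys_iff)
  have [simp]: "x \<otimes>\<^bsub>?R\<^esub> y = x * y" "x \<oplus>\<^bsub>?R\<^esub> y = x + y" "\<one>\<^bsub>?R\<^esub> = 1" "\<zero>\<^bsub>?R\<^esub> = 0" for x y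
    by (simp_all add: mpoly_ring_def)
  show ?thesis
  proof (intro cringI abelian_groupI comm_monoidI)
    show "\<exists>y\<in>carrier ?R. y \<oplus>\<^bsub>?R\<^esub> x = \<zero>\<^bsub>?R\<^esub>" if "x \<in> carrier ?R" for x
      using neg[OF that] by (intro bexI[of _ "- x"]) auto
  qed (use add mult zero one in \<open>auto simp: algebra_simps\<close>)
qed

text \<open>
  Degrees of graded components are integers; components of negative degree are zero.
  For an ideal \<open>I\<close> generated by homogeneous polynomials, the degree \<open>d\<close> component of the
  quotient \<open>K[x\<^sub>0, \<dots>, x\<^sub>n] / I\<close> is the set of residue classes of the homogeneous
  polynomials of degree \<open>d\<close>, the zero polynomial included.
\<close>

definition homogeneous_part :: "nat \<Rightarrow> int \<Rightarrow> 'k::field mpoly set" where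
  "homogeneous_part n d =
     {p \<in> carrier (mpoly_ring n). \<forall>m\<in>Poly_Mapping.keys p. int (mdeg m) = d}"

definition quot_component :: "nat \<Rightarrow> 'k::field mpoly set \<Rightarrow> int \<Rightarrow> 'k mpoly set set" where
  "quot_component n I d = (\<lambda>p. I +>\<^bsub>mpoly_ring n\<^esub> p) ` homogeneous_part n d"

text \<open>
  The strong Lefschetz property of \<open>A = K[x\<^sub>0, \<dots>, x\<^sub>n] / I\<close>, meant for homogeneous ideals
  \<open>I\<close> with artinian quotient. Maximal rank of a map between components is spelled out as
  injectivity or surjectivity.
\<close>

definition strong_lefschetz :: "nat \<Rightarrow> 'k::field mpoly set \<Rightarrow> bool" where
  "strong_lefschetz n I \<longleftrightarrow>
     (let A = mpoly_ring n Quot I in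
      \<exists>l \<in> quot_component n I 1. \<forall>d::int. \<forall>k::nat. k \<ge> 1 \<longrightarrow>
        inj_on (\<lambda>a. (l [^]\<^bsub>A\<^esub> k) \<otimes>\<^bsub>A\<^esub> a) (quot_component n I d) \<or>
        (\<lambda>a. (l [^]\<^bsub>A\<^esub> k) \<otimes>\<^bsub>A\<^esub> a) ` quot_component n I d = quot_component n I (d + int k))"

definition monomial_ci :: "nat \<Rightarrow> (nat \<Rightarrow> nat) \<Rightarrow> 'k::field mpoly set" where
  "monomial_ci n d = genideal (mpoly_ring n) ((\<lambda>i. mvar i ^ d i) ` {..n})"

end

theory Submission
  imports Defs
begin

text \<open>
  If a nonzero monomial of degree \<open>k\<close> is killed by \<open>l\<^bsup>e - 2k\<^esup>\<close>, where \<open>e\<close> is the socle degree, then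
  the strong Lefschetz property fails for \<open>l\<close>. Write \<open>l = x + y + q\<close> with \<open>x, y\<close> multiples of two of
  the variables. In characteristic two \<open>(x + y)\<^sup>2 = x\<^sup>2 + y\<^sup>2\<close>, so a high power of \<open>x + y\<close> times a
  monomial has at most one surviving term, and its coefficient is a binomial coefficient. If both
  exponents are even, \<open>l\<^bsup>e\<^esup>\<close> vanishes. If both are odd, Pascal's rule shows that \<open>l\<^bsup>e\<^esup>\<close>,
  \<open>x l\<^bsup>e-2\<^esup>\<close> or \<open>y l\<^bsup>e-2\<^esup>\<close> vanishes. So the exponents have pairwise distinct parities, which forces
  \<open>n = 1\<close>. The remaining pairs are excluded by the same argument applied to \<open>x\<^sup>2\<close> and \<open>y\<^sup>2\<close>.

  Conversely, multiplication by \<open>x + y\<close> is surjective from degree \<open>d\<^sub>1 - 1\<close> on, which leaves the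
  degrees \<open>0\<close> and \<open>1\<close>.
\<close>

section \<open>Monomials and forms\<close>

lemma mdeg_eq_sum:
  assumes "finite S" "Poly_Mapping.keys m \<subseteq> S"
  shows "mdeg m = (\<Sum>i\<in>S. Poly_Mapping.lookup m i)"
  unfolding mdeg_def using assms by (intro sum.mono_neutral_left) (auto simp: in_keys_iff)

lemma mdeg_zero [simp]: "mdeg 0 = 0"
  by (simp add: mdeg_def)

lemma mdeg_single [simp]: "mdeg (Poly_Mapping.single i a) = a"
  by (simp add: mdeg_def)

lemma mdeg_add [simp]: "mdeg (a + b) = mdeg a + mdeg b"
proof -
  let ?S = "Poly_Mapping.keys a \<union> Poly_Mapping.keys b"
  have "mdeg (a + b) = (\<Sum>i\<in>?S. Poly_Mapping.lookup (a + b) i)"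
    using Poly_Mapping.keys_add[of a b] by (intro mdeg_eq_sum) auto
  also have "\<dots> = mdeg a + mdeg b"
    by (simp add: mdeg_eq_sum[of ?S a] mdeg_eq_sum[of ?S b] lookup_add sum.distrib)
  finally show ?thesis .
qed

lemma keys_add_nat [simp]:
  "Poly_Mapping.keys (a + b) = Poly_Mapping.keys a \<union> Poly_Mapping.keys (b :: monomial)"
  by (auto simp: in_keys_iff lookup_add)

lemma sum_single_keys:
  "(\<Sum>m\<in>Poly_Mapping.keys p. Poly_Mapping.single m (Poly_Mapping.lookup p m)) = p"
  by (intro poly_mapping_eqI) (auto simp: lookup_sum lookup_single when_def in_keys_iff sum.delta')

text \<open>Homogeneous parts with natural degrees and an arbitrary set of variables. The set
  \<open>S\<close> is free because the forms in all variables except two chosen ones are needed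
  later.\<close>

definition forms :: "nat set \<Rightarrow> nat \<Rightarrow> 'k::field mpoly set" where
  "forms S s = {p. \<forall>m\<in>Poly_Mapping.keys p. Poly_Mapping.keys m \<subseteq> S \<and> mdeg m = s}"

lemma forms_zero [simp]: "0 \<in> forms S s"
  by (simp add: forms_def)

lemma forms_single:
  "Poly_Mapping.keys m \<subseteq> S \<Longrightarrow> mdeg m = s \<Longrightarrow> Poly_Mapping.single m c \<in> forms S s"
  by (auto simp: forms_def)

lemma forms_add: "p \<in> forms S s \<Longrightarrow> q \<in> forms S s \<Longrightarrow> p + q \<in> forms S s"
  using Poly_Mapping.keys_add[of p q] unfolding forms_def by blast

lemma forms_diff: "p \<in> forms S s \<Longrightarrow> q \<in> forms S s \<Longrightarrow> p - q \<in> forms S s"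
  using keys_diff[of p q] unfolding forms_def by blast

lemma forms_sum: "(\<And>i. i \<in> T \<Longrightarrow> f i \<in> forms S s) \<Longrightarrow> sum f T \<in> forms S s"
  by (induction T rule: infinite_finite_induct) (auto intro: forms_add)

lemma forms_mult: "p \<in> forms S s \<Longrightarrow> q \<in> forms S t \<Longrightarrow> p * q \<in> forms S (s + t)"
  using keys_mult[of p q] unfolding forms_def by fastforce

lemma forms_power: "p \<in> forms S s \<Longrightarrow> p ^ t \<in> forms S (t * s)"
  by (induction t) (auto simp: forms_single simp flip: single_one intro: forms_mult)

lemma homogeneous_part_int: "homogeneous_part n (int s) = forms {..n} s"
  by (auto simp: homogeneous_part_def forms_def mpoly_ring_def)

lemma homogeneous_part_one: "homogeneous_part n 1 = forms {..n} 1"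
  using homogeneous_part_int[of n 1] by simp

lemma homogeneous_part_neg: "s < 0 \<Longrightarrow> homogeneous_part n s = {0}"
  by (force simp: homogeneous_part_def mpoly_ring_def simp flip: keys_eq_empty)

lemma homogeneous_part_carrier: "p \<in> homogeneous_part n s \<Longrightarrow> p \<in> carrier (mpoly_ring n)"
  by (simp add: homogeneous_part_def)

lemma homogeneous_part_diff:
  "p \<in> homogeneous_part n s \<Longrightarrow> q \<in> homogeneous_part n s \<Longrightarrow> p - q \<in> homogeneous_part n s"
  using keys_diff[of p q] unfolding homogeneous_part_def mpoly_ring_def by simp blast

lemma homogeneous_part_mult:
  assumes "p \<in> homogeneous_part n s" "q \<in> homogeneous_part n t"
  shows "p * q \<in> homogeneous_part n (s + t)"
proof -
  have "Poly_Mapping.keys m \<subseteq> {..n} \<and> int (mdeg m) = s + t"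
    if m: "m \<in> Poly_Mapping.keys (p * q)" for m
  proof -
    obtain a b where "m = a + b" "a \<in> Poly_Mapping.keys p" "b \<in> Poly_Mapping.keys q"
      using keys_mult[of p q] m by blast
    then show ?thesis
      using assms by (simp add: homogeneous_part_def mpoly_ring_def)
  qed
  then show ?thesis by (auto simp: homogeneous_part_def mpoly_ring_def)
qed

section \<open>Ideals of commutative rings of characteristic two\<close>

text \<open>Ideals of a ring that is a whole type. Working here instead of in the record
  \<open>mpoly_ring n\<close> avoids carrier conditions in all computations.\<close>

locale type_ideal =
  fixes J :: "'a::comm_ring_1 set"
  assumes zero_mem [simp]: "0 \<in> J"
    and add_mem: "x \<in> J \<Longrightarrow> y \<in> J \<Longrightarrow> x + y \<in> J"
    and mult_mem: "x \<in> J \<Longrightarrow> y * x \<in> J"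
begin

lemma mult_mem_right: "x \<in> J \<Longrightarrow> x * y \<in> J"
  using mult_mem[of x y] by (simp add: mult.commute)

lemma uminus_mem: "x \<in> J \<Longrightarrow> - x \<in> J"
  using mult_mem[of x "-1"] by simp

lemma diff_mem: "x \<in> J \<Longrightarrow> y \<in> J \<Longrightarrow> x - y \<in> J"
  using add_mem[of x "- y"] uminus_mem[of y] by simp

lemma sum_mem: "(\<And>i. i \<in> T \<Longrightarrow> f i \<in> J) \<Longrightarrow> sum f T \<in> J"
  by (induction T rule: infinite_finite_induct) (auto intro: add_mem)

lemma mult_power_mono: "z * x ^ a \<in> J \<Longrightarrow> a \<le> b \<Longrightarrow> z * x ^ b \<in> J"
  using mult_mem[of "z * x ^ a" "x ^ (b - a)"] by (simp add: mult.left_commute flip: power_add)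

text \<open>Since \<open>N\<close> is at least \<open>a + b - 1\<close>, every term of the binomial
  expansion contains \<open>p\<close> at least \<open>a\<close> times or \<open>q\<close> at least
  \<open>b\<close> times.\<close>

lemma binomial_mem:
  assumes p: "z * p ^ a \<in> J" and q: "q ^ b \<in> J" and N: "a + b \<le> Suc N"
  shows "z * (p + q) ^ N \<in> J"
proof -
  have "z * (of_nat (N choose i) * p ^ i * q ^ (N - i)) \<in> J" if "i \<le> N" for i
  proof (cases "a \<le> i")
    case True
    have "z * p ^ i * (of_nat (N choose i) * q ^ (N - i)) \<in> J"
      by (intro mult_mem_right mult_power_mono[OF p] True)
    then show ?thesis by (simp add: algebra_simps)
  next
    case False
    then have "1 * q ^ (N - i) \<in> J"
      using mult_power_mono[of 1 q b "N - i"] N q by simp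
    then have "z * of_nat (N choose i) * p ^ i * q ^ (N - i) \<in> J"
      by (intro mult_mem) simp
    then show ?thesis by (simp add: algebra_simps)
  qed
  then show ?thesis
    unfolding binomial_ring sum_distrib_left by (intro sum_mem) auto
qed

end

lemma of_nat_even_char2:
  assumes "(2 :: 'a::comm_ring_1) = 0" "even k"
  shows "(of_nat k :: 'a) = 0"
  using assms by (auto elim!: evenE)

lemma power2_sum_char2:
  assumes "(2 :: 'a::comm_ring_1) = 0"
  shows "(x + y :: 'a)\<^sup>2 = x\<^sup>2 + y\<^sup>2"
  by (simp add: power2_sum assms)

lemma power_sum_char2:
  assumes "(2 :: 'a::comm_ring_1) = 0"
  shows "(x + y :: 'a) ^ (2 * m) = (x\<^sup>2 + y\<^sup>2) ^ m"
  by (simp add: power_mult power2_sum_char2[OF assms])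

locale type_ideal_char2 = type_ideal J for J :: "'a::comm_ring_1 set" +
  assumes two_eq_zero: "(2 :: 'a) = 0"
begin

text \<open>Only the term \<open>u\<^sup>A v\<^sup>B\<close> of the binomial expansion survives modulo \<open>J\<close>.\<close>

lemma central_binomial_mem:
  assumes u: "z * u ^ Suc A \<in> J" and v: "z * v ^ Suc B \<in> J" and ev: "even (A + B choose A)"
  shows "z * (u + v) ^ (A + B) \<in> J"
proof -
  have "z * (of_nat (A + B choose i) * u ^ i * v ^ (A + B - i)) \<in> J" for i
  proof (cases i A rule: linorder_cases)
    case less
    then have "z * v ^ (A + B - i) * (of_nat (A + B choose i) * u ^ i) \<in> J"
      by (intro mult_mem_right mult_power_mono[OF v]) auto
    then show ?thesis by (simp add: algebra_simps)
  next
    case equal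
    then show ?thesis using of_nat_even_char2[OF two_eq_zero ev] by simp
  next
    case greater
    then have "z * u ^ i * (of_nat (A + B choose i) * v ^ (A + B - i)) \<in> J"
      by (intro mult_mem_right mult_power_mono[OF u]) auto
    then show ?thesis by (simp add: algebra_simps)
  qed
  then show ?thesis
    unfolding binomial_ring sum_distrib_left by (intro sum_mem) auto
qed

text \<open>
  By Pascal's rule one of \<open>binom (r + t) r\<close>, \<open>binom (r + t - 1) (r - 1)\<close> and
  \<open>binom (r + t - 1) r\<close> is even.
\<close>

lemma even_even_mem:
  assumes x: "z * x ^ Suc (2 * r) \<in> J" and y: "z * y ^ Suc (2 * t) \<in> J" and pos: "r \<ge> 1" "t \<ge> 1"
  shows "z * (x + y) ^ (2 * (r + t)) \<in> J \<or> z * x * (x + y) ^ (2 * (r + t - 1)) \<in> J \<or>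
    z * y * (x + y) ^ (2 * (r + t - 1)) \<in> J"
proof -
  obtain r' t' where rt: "r = Suc r'" "t = Suc t'"
    using pos by (metis Suc_le_D One_nat_def)
  have zx: "z * (x\<^sup>2) ^ Suc r \<in> J" and zy: "z * (y\<^sup>2) ^ Suc t \<in> J"
    using mult_power_mono[OF x, of "2 * Suc r"] mult_power_mono[OF y, of "2 * Suc t"]
    unfolding power_mult[symmetric] by simp_all
  \<comment> \<open>A factor x absorbs the odd part of the exponent \<open>2 * r + 1\<close>, so
    replacing \<open>z\<close> by \<open>z * x\<close> lowers the bound for the square of x by one
    and keeps the bound for the square of y.\<close>
  have xx: "z * x * (x\<^sup>2) ^ Suc r' \<in> J" and yy: "z * y * (y\<^sup>2) ^ Suc t' \<in> J"
    using x y unfolding power_mult[symmetric] by (simp_all only: rt power_Suc mult.assoc)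
  have xy: "z * x * (y\<^sup>2) ^ Suc t \<in> J" and yx: "z * y * (x\<^sup>2) ^ Suc r \<in> J"
    using mult_mem[OF zx, of y] mult_mem[OF zy, of x] by (simp_all add: algebra_simps)
  have "(r + t choose r) = (r' + t choose r') + (r + t' choose r)"
    by (simp add: rt)
  then consider "even (r + t choose r)" | "even (r' + t choose r')" | "even (r + t' choose r)"
    by (metis even_add)
  then show ?thesis
  proof cases
    case 1
    from central_binomial_mem[OF zx zy 1] show ?thesis
      unfolding power_sum_char2[OF two_eq_zero] by simp
  next
    case 2
    from central_binomial_mem[OF xx xy 2] show ?thesis
      unfolding power_sum_char2[OF two_eq_zero] by (simp add: rt)
  next
    case 3
    from central_binomial_mem[OF yx yy 3] show ?thesis
      unfolding power_sum_char2[OF two_eq_zero] by (simp add: rt)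
  qed
qed

end

text \<open>The absorption identity a * binom(a+b, a) = (a+b) * binom(a+b-1, a-1) has an even
  right-hand side, while the factor a is odd.\<close>

lemma even_choose_odd_odd:
  assumes "odd a" "odd b"
  shows "even (a + b choose a)"
proof -
  obtain a' where a: "a = Suc a'" using assms(1) by (cases a) auto
  have "Suc a' * (a + b choose a) = (a + b) * (a' + b choose a')"
    using Suc_times_binomial_eq[of "a' + b" a'] by (simp add: a algebra_simps)
  then show ?thesis
    by (metis a assms even_add even_mult_iff)
qed

section \<open>The strong Lefschetz property modulo the monomial ideal\<close>

text \<open>The same monomial ideal, extended to the polynomial ring in all variables. Being a span
  of monomials, it has a membership test on each key separately; \<open>monomial_ci_eq\<close> links
  it to the generated ideal.\<close>

definition ci_span :: "nat \<Rightarrow> (nat \<Rightarrow> nat) \<Rightarrow> 'k::field mpoly set" where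
  "ci_span n d = {p. \<forall>m\<in>Poly_Mapping.keys p. \<exists>i\<le>n. d i \<le> Poly_Mapping.lookup m i}"

interpretation ci: type_ideal "ci_span n d :: 'k::field mpoly set" for n d
proof
  fix p q :: "'k mpoly"
  show "0 \<in> ci_span n d" by (simp add: ci_span_def)
  show "p + q \<in> ci_span n d" if "p \<in> ci_span n d" "q \<in> ci_span n d"
    using that Poly_Mapping.keys_add[of p q] unfolding ci_span_def by blast
  show "q * p \<in> ci_span n d" if p: "p \<in> ci_span n d"
    unfolding ci_span_def
  proof safe
    fix m assume "m \<in> Poly_Mapping.keys (q * p)"
    then obtain a b where m: "m = a + b" "b \<in> Poly_Mapping.keys p"
      using keys_mult[of q p] by blast
    then obtain i where "i \<le> n" "d i \<le> Poly_Mapping.lookup b i"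
      using p by (auto simp: ci_span_def)
    then show "\<exists>i\<le>n. d i \<le> Poly_Mapping.lookup m i"
      by (auto simp: m lookup_add intro!: exI[of _ i])
  qed
qed

lemma single_mem_ci_span_iff:
  "Poly_Mapping.single m c \<in> ci_span n d \<longleftrightarrow> c = 0 \<or> (\<exists>i\<le>n. d i \<le> Poly_Mapping.lookup m i)"
  by (auto simp: ci_span_def)

lemma mvar_power: "(mvar i :: 'k::field mpoly) ^ a = Poly_Mapping.single (Poly_Mapping.single i a) 1"
  by (induction a) (auto simp: mvar_def mult_single simp flip: single_add)

text \<open>Pigeonhole: a monomial in the variables \<open>S\<close> whose exponents all stay below
  \<open>d i\<close> has degree at most the sum of the \<open>d i - 1\<close>.\<close>

lemma forms_mem_ci_span:
  assumes S: "S \<subseteq> {..n}" and s: "(\<Sum>i\<in>S. d i - 1) < s" and p: "p \<in> forms S s"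
  shows "p \<in> ci_span n d"
  unfolding ci_span_def
proof safe
  fix m assume "m \<in> Poly_Mapping.keys p"
  then have m: "Poly_Mapping.keys m \<subseteq> S" "mdeg m = s" using p by (auto simp: forms_def)
  have "finite S" using S finite_subset by blast
  show "\<exists>i\<le>n. d i \<le> Poly_Mapping.lookup m i"
  proof (rule ccontr)
    assume *: "\<not> ?thesis"
    have "mdeg m = (\<Sum>i\<in>S. Poly_Mapping.lookup m i)"
      by (intro mdeg_eq_sum \<open>finite S\<close> m)
    also have "\<dots> \<le> (\<Sum>i\<in>S. d i - 1)"
      using * S by (intro sum_mono) force
    finally show False using s m by simp
  qed
qed

section \<open>The generated ideal and its quotient ring\<close>

lemma mpoly_ring_simps [simp]:
  "x \<otimes>\<^bsub>mpoly_ring n\<^esub> y = x * y" "x \<oplus>\<^bsub>mpoly_ring n\<^esub> y = x + y"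
  "\<one>\<^bsub>mpoly_ring n\<^esub> = 1" "\<zero>\<^bsub>mpoly_ring n\<^esub> = 0"
  by (simp_all add: mpoly_ring_def)

lemma mpoly_ring_pow [simp]: "(x :: 'k::field mpoly) [^]\<^bsub>mpoly_ring n\<^esub> (k::nat) = x ^ k"
  by (induction k) (simp_all add: nat_pow_def mult.commute)

lemma mpoly_ring_minus [simp]:
  fixes x y :: "'k::field mpoly"
  assumes "y \<in> carrier (mpoly_ring n)"
  shows "x \<ominus>\<^bsub>mpoly_ring n\<^esub> y = x - y"
proof -
  interpret cring "mpoly_ring n :: 'k mpoly ring" by (rule cring_mpoly_ring)
  have "- y \<in> carrier (mpoly_ring n)"
    using assms by (auto simp: mpoly_ring_def in_keys_iff)
  then have "\<ominus>\<^bsub>mpoly_ring n\<^esub> y = - y"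
    using assms by (intro minus_equality) auto
  then show ?thesis by (simp add: a_minus_def)
qed

lemma mvar_carrier: "i \<le> n \<Longrightarrow> mvar i ^ a \<in> carrier (mpoly_ring n)"
  by (auto simp: mvar_power mpoly_ring_def)

lemma ideal_monomial_ci: "ideal (monomial_ci n d) (mpoly_ring n :: 'k::field mpoly ring)"
proof -
  interpret cring "mpoly_ring n :: 'k mpoly ring" by (rule cring_mpoly_ring)
  show ?thesis
    unfolding monomial_ci_def by (rule genideal_ideal) (auto intro: mvar_carrier)
qed

text \<open>One inclusion is minimality of the generated ideal. For the other, every term of a
  member of the span is a multiple of some generator.\<close>

lemma monomial_ci_eq:
  "monomial_ci n d = ci_span n d \<inter> carrier (mpoly_ring n :: 'k::field mpoly ring)"
proof
  interpret cring "mpoly_ring n :: 'k mpoly ring" by (rule cring_mpoly_ring)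
  interpret I: ideal "monomial_ci n d" "mpoly_ring n :: 'k mpoly ring" by (rule ideal_monomial_ci)
  have uminus: "a_inv (mpoly_ring n) x = - x" if "x \<in> carrier (mpoly_ring n)" for x :: "'k mpoly"
    using mpoly_ring_minus[OF that, of 0] that by (simp add: a_minus_def)
  have "ideal (ci_span n d \<inter> carrier (mpoly_ring n)) (mpoly_ring n :: 'k mpoly ring)"
  proof (rule idealI)
    show "subgroup (ci_span n d \<inter> carrier (mpoly_ring n)) (add_monoid (mpoly_ring n :: 'k mpoly ring))"
    proof (rule add.subgroupI)
      show "a_inv (mpoly_ring n) x \<in> ci_span n d \<inter> carrier (mpoly_ring n)"
        if "x \<in> ci_span n d \<inter> carrier (mpoly_ring n)" for x :: "'k mpoly"
        using that a_inv_closed[of x] by (auto simp: uminus ci.uminus_mem)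
      show "x \<oplus>\<^bsub>mpoly_ring n\<^esub> y \<in> ci_span n d \<inter> carrier (mpoly_ring n)"
        if "x \<in> ci_span n d \<inter> carrier (mpoly_ring n)" "y \<in> ci_span n d \<inter> carrier (mpoly_ring n)"
        for x y :: "'k mpoly"
        using that a_closed[of x y] by (auto simp: ci.add_mem)
      have "0 \<in> ci_span n d \<inter> carrier (mpoly_ring n :: 'k mpoly ring)"
        using zero_closed by simp
      then show "ci_span n d \<inter> carrier (mpoly_ring n :: 'k mpoly ring) \<noteq> {}" by blast
    qed auto
  qed (use m_closed in \<open>auto simp: ci.mult_mem ci.mult_mem_right ring_axioms\<close>)
  then show "monomial_ci n d \<subseteq> ci_span n d \<inter> carrier (mpoly_ring n :: 'k mpoly ring)"
    unfolding monomial_ci_def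
  proof (rule genideal_minimal, intro image_subsetI IntI mvar_carrier)
    fix i assume "i \<in> {..n}"
    then show "mvar i ^ d i \<in> ci_span n d"
      by (auto simp: mvar_power single_mem_ci_span_iff intro!: exI[of _ i])
  qed auto
  show "ci_span n d \<inter> carrier (mpoly_ring n :: 'k mpoly ring) \<subseteq> monomial_ci n d"
  proof safe
    fix p :: "'k mpoly"
    assume p: "p \<in> ci_span n d" "p \<in> carrier (mpoly_ring n)"
    have mon: "Poly_Mapping.single m c \<in> monomial_ci n d" if m: "m \<in> Poly_Mapping.keys p" for m and c :: 'k
    proof -
      obtain i where i: "i \<le> n" "d i \<le> Poly_Mapping.lookup m i"
        using p(1) m by (auto simp: ci_span_def)
      let ?m = "m - Poly_Mapping.single i (d i)"
      have eq: "m = ?m + Poly_Mapping.single i (d i)"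
        using i by (intro poly_mapping_eqI) (auto simp: lookup_add lookup_minus lookup_single when_def)
      have "Poly_Mapping.keys ?m \<subseteq> Poly_Mapping.keys m"
        by (auto simp: in_keys_iff lookup_minus)
      then have "Poly_Mapping.single ?m c \<in> carrier (mpoly_ring n)"
        using p(2) m by (auto simp: mpoly_ring_def)
      moreover have "(mvar i :: 'k mpoly) ^ d i \<in> monomial_ci n d"
        unfolding monomial_ci_def using i
        by (intro set_mp[OF genideal_self]) (auto intro: mvar_carrier)
      ultimately have "Poly_Mapping.single ?m c * mvar i ^ d i \<in> monomial_ci n d"
        using I.I_l_closed[of "mvar i ^ d i" "Poly_Mapping.single ?m c"] by simp
      then show ?thesis
        by (simp add: mvar_power mult_single flip: eq)
    qed
    have "sum f T \<in> monomial_ci n d" if "\<And>x. x \<in> T \<Longrightarrow> f x \<in> monomial_ci n d"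
      for f :: "monomial \<Rightarrow> 'k mpoly" and T
      using that I.a_closed I.zero_closed
      by (induction T rule: infinite_finite_induct) auto
    from this[of "Poly_Mapping.keys p", OF mon] show "p \<in> monomial_ci n d"
      by (subst sum_single_keys[symmetric])
  qed
qed

text \<open>Removes cosets from the definition. By additivity injectivity is triviality of the
  kernel, and for surjectivity only one inclusion is at stake, as the product map always lands in
  degree \<open>e + int k\<close>.\<close>

lemma strong_lefschetz_iff:
  "strong_lefschetz n (monomial_ci n d :: 'k::field mpoly set) \<longleftrightarrow>
    (\<exists>l\<in>homogeneous_part n 1. \<forall>e. \<forall>k::nat. k \<ge> 1 \<longrightarrow>
      (\<forall>f\<in>homogeneous_part n e. l ^ k * f \<in> ci_span n d \<longrightarrow> f \<in> (ci_span n d :: 'k mpoly set)) \<or>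
      (\<forall>g\<in>homogeneous_part n (e + int k). \<exists>f\<in>homogeneous_part n e. l ^ k * f - g \<in> ci_span n d))"
    (is "_ \<longleftrightarrow> (\<exists>l\<in>_. \<forall>e k. _ \<longrightarrow> ?inj l e k \<or> ?surj l e k)")
proof -
  interpret cring "mpoly_ring n :: 'k mpoly ring" by (rule cring_mpoly_ring)
  let ?R = "mpoly_ring n :: 'k mpoly ring" and ?I = "monomial_ci n d :: 'k mpoly set"
  let ?A = "?R Quot ?I"
  interpret I: ideal ?I ?R by (rule ideal_monomial_ci)
  interpret h: ring_hom_ring ?R ?A "(+>\<^bsub>?R\<^esub>) ?I" by (rule I.rcos_ring_hom_ring)
  have coset_eq: "?I +>\<^bsub>?R\<^esub> p = ?I +>\<^bsub>?R\<^esub> q \<longleftrightarrow> p - q \<in> ci_span n d"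
    if "p \<in> carrier ?R" "q \<in> carrier ?R" for p q
    using quotient_eq_iff_same_a_r_cos[OF ideal_monomial_ci that, of d] that
      minus_closed[OF that] by (simp add: monomial_ci_eq)
  have pow_carrier: "l ^ k \<in> carrier ?R" if "l \<in> carrier ?R" for l and k :: nat
    using nat_pow_closed[OF that, of k] by simp
  have mult_coset: "((?I +>\<^bsub>?R\<^esub> l) [^]\<^bsub>?A\<^esub> k) \<otimes>\<^bsub>?A\<^esub> (?I +>\<^bsub>?R\<^esub> f) = ?I +>\<^bsub>?R\<^esub> (l ^ k * f)"
    if "l \<in> carrier ?R" "f \<in> carrier ?R" for l f and k :: nat
    using h.hom_nat_pow[OF that(1), of k] h.hom_mult[OF pow_carrier[OF that(1)] that(2), of k] by simp
  have inj: "inj_on (\<lambda>a. ((?I +>\<^bsub>?R\<^esub> l) [^]\<^bsub>?A\<^esub> k) \<otimes>\<^bsub>?A\<^esub> a) (quot_component n ?I e) \<longleftrightarrow> ?inj l e k"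
    if l: "l \<in> homogeneous_part n 1" for l e and k :: nat
  proof -
    note lc = homogeneous_part_carrier[OF l]
    have "inj_on (\<lambda>a. ((?I +>\<^bsub>?R\<^esub> l) [^]\<^bsub>?A\<^esub> k) \<otimes>\<^bsub>?A\<^esub> a) (quot_component n ?I e) \<longleftrightarrow>
      (\<forall>f\<in>homogeneous_part n e. \<forall>g\<in>homogeneous_part n e.
        l ^ k * f - l ^ k * g \<in> ci_span n d \<longrightarrow> f - g \<in> ci_span n d)"
      unfolding quot_component_def inj_on_def
      using m_closed[OF pow_carrier[OF lc]]
      by (auto simp: mult_coset[OF lc] coset_eq homogeneous_part_carrier)
    also have "\<dots> \<longleftrightarrow> ?inj l e k"
    proof safe
      fix f g assume "?inj l e k" "f \<in> homogeneous_part n e" "g \<in> homogeneous_part n e"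
        "l ^ k * f - l ^ k * g \<in> ci_span n d"
      then show "f - g \<in> ci_span n d"
        using homogeneous_part_diff[of f n e g] by (auto simp: right_diff_distrib)
    next
      fix f assume *: "\<forall>f\<in>homogeneous_part n e. \<forall>g\<in>homogeneous_part n e.
        l ^ k * f - l ^ k * g \<in> ci_span n d \<longrightarrow> f - g \<in> ci_span n d"
        "f \<in> homogeneous_part n e" "l ^ k * f \<in> ci_span n d"
      have "0 \<in> homogeneous_part n e" by (simp add: homogeneous_part_def mpoly_ring_def)
      from *(1)[rule_format, OF *(2) this] *(3) show "f \<in> ci_span n d" by simp
    qed
    finally show ?thesis .
  qed
  have surj: "(\<lambda>a. ((?I +>\<^bsub>?R\<^esub> l) [^]\<^bsub>?A\<^esub> k) \<otimes>\<^bsub>?A\<^esub> a) ` quot_component n ?I e =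
      quot_component n ?I (e + int k) \<longleftrightarrow> ?surj l e k"
    if l: "l \<in> homogeneous_part n 1" for l e and k :: nat
  proof -
    note lc = homogeneous_part_carrier[OF l]
    have lk: "l ^ k \<in> homogeneous_part n (int k)"
      using l forms_power[of l "{..n}" 1 k] by (simp add: homogeneous_part_int homogeneous_part_one)
    have lf: "l ^ k * f \<in> homogeneous_part n (e + int k)" if "f \<in> homogeneous_part n e" for f
      using homogeneous_part_mult[OF that lk] by (simp add: mult.commute)
    have im: "(\<lambda>a. ((?I +>\<^bsub>?R\<^esub> l) [^]\<^bsub>?A\<^esub> k) \<otimes>\<^bsub>?A\<^esub> a) ` quot_component n ?I e =
      (\<lambda>f. ?I +>\<^bsub>?R\<^esub> (l ^ k * f)) ` homogeneous_part n e"
      unfolding quot_component_def image_image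
      by (intro image_cong refl) (simp add: mult_coset[OF lc] homogeneous_part_carrier)
    have "(\<lambda>f. ?I +>\<^bsub>?R\<^esub> (l ^ k * f)) ` homogeneous_part n e \<subseteq> quot_component n ?I (e + int k)"
      using lf by (auto simp: quot_component_def)
    then have "?thesis \<longleftrightarrow> quot_component n ?I (e + int k) \<subseteq>
        (\<lambda>f. ?I +>\<^bsub>?R\<^esub> (l ^ k * f)) ` homogeneous_part n e \<longleftrightarrow> ?surj l e k"
      unfolding im set_eq_subset[of _ "quot_component n ?I (e + int k)"] by simp
    moreover have "quot_component n ?I (e + int k) \<subseteq>
        (\<lambda>f. ?I +>\<^bsub>?R\<^esub> (l ^ k * f)) ` homogeneous_part n e \<longleftrightarrow>
      (\<forall>g\<in>homogeneous_part n (e + int k). \<exists>f\<in>homogeneous_part n e.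
        ?I +>\<^bsub>?R\<^esub> g = ?I +>\<^bsub>?R\<^esub> (l ^ k * f))"
      unfolding quot_component_def image_subset_iff image_iff by (rule refl)
    moreover have "\<dots> \<longleftrightarrow> ?surj l e k"
      using lf by (intro ball_cong bex_cong refl trans[OF eq_commute coset_eq] homogeneous_part_carrier) auto
    ultimately show ?thesis by argo
  qed
  show ?thesis
    unfolding strong_lefschetz_def Let_def quot_component_def[of n ?I 1] bex_simps(7)
    by (simp only: inj surj cong: bex_cong)
qed

section \<open>Characteristic two and linear forms\<close>

lemma two_eq_zero_mpoly: "(2 :: 'k::field) = 0 \<Longrightarrow> (2 :: 'k mpoly) = 0"
  by (metis single_numeral single_zero)

lemma mdeg_eq_one: "mdeg m = 1 \<Longrightarrow> \<exists>t. m = Poly_Mapping.single t 1"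
  unfolding mdeg_def
  by (subst (asm) sum_eq_1_iff)
     (force simp: lookup_single when_def in_keys_iff intro!: poly_mapping_eqI)+

lemma linear_form_eq_sum:
  fixes l :: "'k::field mpoly"
  assumes "l \<in> forms {..n} 1"
  shows "l = (\<Sum>t\<le>n. Poly_Mapping.single (Poly_Mapping.single t 1)
    (Poly_Mapping.lookup l (Poly_Mapping.single t 1)))"
proof (intro poly_mapping_eqI)
  fix m :: monomial
  let ?s = "\<Sum>t\<le>n. if Poly_Mapping.single t 1 = m
    then Poly_Mapping.lookup l (Poly_Mapping.single t 1) else 0"
  have "Poly_Mapping.lookup l m = ?s"
  proof (cases "\<exists>t\<le>n. m = Poly_Mapping.single t 1")
    case True
    then obtain t where t: "t \<le> n" "m = Poly_Mapping.single t 1" by blast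
    have "?s = (\<Sum>t'\<le>n. if t' = t then Poly_Mapping.lookup l m else 0)"
      by (intro sum.cong) (auto simp: t dest: arg_cong[where f = Poly_Mapping.keys])
    then show ?thesis using t by simp
  next
    case False
    have "Poly_Mapping.lookup l m = 0"
    proof (rule ccontr)
      assume "Poly_Mapping.lookup l m \<noteq> 0"
      then have m: "Poly_Mapping.keys m \<subseteq> {..n}" "mdeg m = 1"
        using assms by (auto simp: forms_def in_keys_iff)
      with mdeg_eq_one obtain t where t: "m = Poly_Mapping.single t 1" by blast
      then have "t \<le> n" using m(1) by simp
      with t False show "False" by blast
    qed
    moreover have "?s = 0" using False by (intro sum.neutral) auto
    ultimately show ?thesis by simp
  qed
  then show "Poly_Mapping.lookup l m = Poly_Mapping.lookup (\<Sum>t\<le>n.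
      Poly_Mapping.single (Poly_Mapping.single t 1)
        (Poly_Mapping.lookup l (Poly_Mapping.single t 1))) m"
    by (simp only: lookup_sum lookup_single when_def)
qed

section \<open>Necessary conditions\<close>

text \<open>The situation of the forward direction: \<open>l\<close> is a representative of a strong
  Lefschetz element.\<close>

locale lefschetz_char2 =
  fixes n :: nat and d :: "nat \<Rightarrow> nat" and l :: "'k::field mpoly"
  assumes n_pos: "n \<ge> 1"
    and d_ge_2: "i \<le> n \<Longrightarrow> d i \<ge> 2"
    and char2: "(2 :: 'k) = 0"
    and linear: "l \<in> forms {..n} 1"
    and maximal_rank: "k \<ge> 1 \<Longrightarrow>
      (\<forall>f\<in>homogeneous_part n e. l ^ k * f \<in> ci_span n d \<longrightarrow> f \<in> ci_span n d) \<or>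
      (\<forall>g\<in>homogeneous_part n (e + int k). \<exists>f\<in>homogeneous_part n e. l ^ k * f - g \<in> ci_span n d)"
begin

sublocale J: type_ideal_char2 "ci_span n d :: 'k mpoly set"
  by unfold_locales (rule two_eq_zero_mpoly[OF char2])

text \<open>With the coefficient kept inside \<open>X i\<close>, the form \<open>l\<close> is the
  plain sum of the \<open>X i\<close>, and no rescaling of variables is required.\<close>

definition X :: "nat \<Rightarrow> 'k mpoly" where
  "X i = Poly_Mapping.single (Poly_Mapping.single i 1)
    (Poly_Mapping.lookup l (Poly_Mapping.single i 1))"

definition socle_degree :: nat where
  "socle_degree = (\<Sum>i\<le>n. d i - 1)"

text \<open>
  If \<open>l\<^sup>k\<close> kills the monomial \<open>x\<^sup>m\<close>, where \<open>2 deg m + k\<close> is the socle degree, then it is not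
  injective. It is not surjective either: everything in its image is killed by \<open>x\<^sup>m\<close>, but the
  complementary monomial is not.
\<close>

lemma monomial_not_killed:
  assumes m: "Poly_Mapping.keys m \<subseteq> {..n}" "\<And>i. i \<le> n \<Longrightarrow> Poly_Mapping.lookup m i < d i"
    and b: "b \<noteq> 0" and N: "2 * mdeg m + N \<le> socle_degree" "2 * mdeg m < socle_degree"
  shows "Poly_Mapping.single m b * l ^ N \<notin> ci_span n d"
proof
  assume "Poly_Mapping.single m b * l ^ N \<in> ci_span n d"
  moreover define k where "k = socle_degree - 2 * mdeg m"
  ultimately have kill: "Poly_Mapping.single m b * l ^ k \<in> ci_span n d"
    using ci.mult_power_mono N(1) by (metis add_le_imp_le_diff add.commute)
  have k: "k \<ge> 1" using N(2) by (simp add: k_def)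
  \<comment> \<open>The exponent of the socle monomial, the product of all x_i^(d_i - 1). The
    complement \<open>c - m\<close> has degree \<open>mdeg m + k\<close>, so it lies in the target
    of multiplication by \<open>l ^ k\<close>.\<close>
  define c where "c = (\<Sum>i\<le>n. Poly_Mapping.single i (d i - 1))"
  have c: "Poly_Mapping.lookup c i = (if i \<le> n then d i - 1 else 0)" for i
    by (simp add: c_def lookup_sum lookup_single when_def)
  have mc: "m + (c - m) = c"
  proof (intro poly_mapping_eqI)
    fix i show "Poly_Mapping.lookup (m + (c - m)) i = Poly_Mapping.lookup c i"
      using m(2)[of i] m(1) by (cases "i \<le> n") (auto simp: lookup_add lookup_minus c in_keys_iff)
  qed
  have keys_c: "Poly_Mapping.keys c \<subseteq> {..n}" by (auto simp: in_keys_iff c split: if_splits)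
  have "mdeg c = socle_degree"
    using mdeg_eq_sum[OF _ keys_c] by (simp add: c socle_degree_def)
  then have deg: "mdeg (c - m) = mdeg m + k"
    using mdeg_add[of m "c - m"] N by (simp add: mc k_def)
  have f: "Poly_Mapping.single m b \<in> homogeneous_part n (int (mdeg m))"
    using m(1) by (simp add: homogeneous_part_int forms_single)
  have "Poly_Mapping.single m b \<notin> ci_span n d"
    using m(2) b by (metis single_mem_ci_span_iff not_le)
  then have surj: "\<exists>f\<in>homogeneous_part n (int (mdeg m)). l ^ k * f - g \<in> ci_span n d"
    if "g \<in> homogeneous_part n (int (mdeg m) + int k)" for g
    using maximal_rank[OF k, of "int (mdeg m)"] f kill that by (auto simp: mult.commute)
  have keys_g: "Poly_Mapping.keys (c - m) \<subseteq> {..n}"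
    by (auto simp: in_keys_iff lookup_minus c split: if_splits)
  have "Poly_Mapping.single (c - m) 1 \<in> homogeneous_part n (int (mdeg m) + int k)"
    using forms_single[OF keys_g deg] by (simp add: homogeneous_part_int flip: of_nat_add)
  then obtain h where "l ^ k * h - Poly_Mapping.single (c - m) 1 \<in> ci_span n d"
    using surj by blast
  then have "Poly_Mapping.single m b * l ^ k * h
      - Poly_Mapping.single m b * (l ^ k * h - Poly_Mapping.single (c - m) 1) \<in> ci_span n d"
    by (rule ci.diff_mem[OF ci.mult_mem_right[OF kill] ci.mult_mem])
  also have "Poly_Mapping.single m b * l ^ k * h
      - Poly_Mapping.single m b * (l ^ k * h - Poly_Mapping.single (c - m) 1) =
    Poly_Mapping.single c b"
    by (simp add: algebra_simps mult_single mc)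
  finally have "\<exists>i\<le>n. d i \<le> d i - 1"
    using b by (auto simp: single_mem_ci_span_iff c split: if_splits)
  then show False using d_ge_2 by fastforce
qed

section \<open>Isolating two of the variables\<close>

lemma X_power: "X i ^ u =
    Poly_Mapping.single (Poly_Mapping.single i u) (Poly_Mapping.lookup l (Poly_Mapping.single i 1) ^ u)"
  by (induction u) (simp_all add: X_def mult_single flip: single_add)

lemma X_power_mem: "i \<le> n \<Longrightarrow> X i ^ d i \<in> ci_span n d"
  by (auto simp: X_power single_mem_ci_span_iff intro!: exI[of _ i])

text \<open>The case of the monomial 1 in \<open>monomial_not_killed\<close>; the socle degree is
  positive because every \<open>d i - 1\<close> is.\<close>

lemma power_not_mem: "l ^ socle_degree \<notin> ci_span n d"
proof -
  have "socle_degree \<ge> (\<Sum>i\<le>n. 1)"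
    unfolding socle_degree_def using d_ge_2 by (intro sum_mono) force
  then show ?thesis
    using monomial_not_killed[of 0 1 socle_degree] d_ge_2 by force
qed

text \<open>Here \<open>q\<close> collects the remaining variables and \<open>e\<close> is the socle
  degree that they contribute, so \<open>q ^ Suc e\<close> vanishes modulo the ideal for degree
  reasons.\<close>

lemma pair_split:
  assumes "i \<le> n" "j \<le> n" "i \<noteq> j"
  obtains q e where "X i + X j + q = l" "q ^ Suc e \<in> ci_span n d"
    "socle_degree = (d i - 1) + (d j - 1) + e" "n = 1 \<Longrightarrow> q = 0"
proof
  let ?S = "{..n} - {i, j}"
  have split: "sum f {..n} = f i + f j + sum f ?S" for f :: "nat \<Rightarrow> 'b::comm_monoid_add"
    using assms sum.remove[of "{..n}" i f] sum.remove[of "{..n} - {i}" j f]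
    by (simp add: Diff_insert2[symmetric] add.assoc)
  show "X i + X j + (\<Sum>t\<in>?S. X t) = l"
    using linear_form_eq_sum[OF linear, symmetric] unfolding X_def[symmetric] split .
  show "socle_degree = (d i - 1) + (d j - 1) + (\<Sum>t\<in>?S. d t - 1)"
    unfolding socle_degree_def split ..
  have "(\<Sum>t\<in>?S. X t) \<in> forms ?S 1"
    by (intro forms_sum) (auto simp: X_def intro: forms_single)
  from forms_power[OF this, of "Suc (\<Sum>t\<in>?S. d t - 1)"]
  show "(\<Sum>t\<in>?S. X t) ^ Suc (\<Sum>t\<in>?S. d t - 1) \<in> ci_span n d"
    by (intro forms_mem_ci_span[of ?S]) auto
  show "(\<Sum>t\<in>?S. X t) = 0" if "n = 1"
  proof -
    have empty: "?S = {}" using assms that by auto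
    show ?thesis unfolding empty by simp
  qed
qed

text \<open>If this power vanished, \<open>binomial_mem\<close> applied to the pair and the rest
  \<open>q\<close> would make \<open>l ^ socle_degree\<close> vanish.\<close>

lemma pair_power_not_mem:
  assumes "i \<le> n" "j \<le> n" "i \<noteq> j"
  shows "(X i + X j) ^ ((d i - 1) + (d j - 1)) \<notin> ci_span n d"
proof
  obtain q e where q: "X i + X j + q = l" "q ^ Suc e \<in> ci_span n d"
    "socle_degree = (d i - 1) + (d j - 1) + e" using pair_split[OF assms] by metis
  assume "(X i + X j) ^ ((d i - 1) + (d j - 1)) \<in> ci_span n d"
  then have "1 * (X i + X j) ^ ((d i - 1) + (d j - 1)) \<in> ci_span n d" by simp
  from ci.binomial_mem[OF this q(2), of socle_degree] show False
    using power_not_mem by (simp add: q(1,3))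
qed

text \<open>If x_i did not occur in \<open>l\<close>, then \<open>X i + X j\<close> would be
  \<open>X j\<close>, whose power \<open>d j\<close> already vanishes; the exponent in
  \<open>pair_power_not_mem\<close> is at least that large.\<close>

lemma coeff_nonzero:
  assumes "i \<le> n"
  shows "Poly_Mapping.lookup l (Poly_Mapping.single i 1) \<noteq> 0"
proof
  assume *: "Poly_Mapping.lookup l (Poly_Mapping.single i 1) = 0"
  define j where "j = (if i = 0 then 1 else 0 :: nat)"
  have j: "j \<le> n" "i \<noteq> j" using n_pos by (auto simp: j_def)
  have "1 * X j ^ ((d i - 1) + (d j - 1)) \<in> ci_span n d"
    by (rule ci.mult_power_mono[of 1 _ "d j"])
       (use d_ge_2[OF assms] d_ge_2[OF j(1)] X_power_mem[OF j(1)] in auto)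
  then show False
    using pair_power_not_mem[OF assms j] * by (simp add: X_def)
qed

lemma X_not_killed:
  assumes "i \<le> n" "j \<le> n" "i \<noteq> j" "u < d i" "v < d j"
    and "2 * (u + v) + N \<le> socle_degree" "2 * (u + v) < socle_degree"
  shows "X i ^ u * X j ^ v * l ^ N \<notin> ci_span n d"
proof -
  have "Poly_Mapping.lookup (Poly_Mapping.single i u + Poly_Mapping.single j v) t < d t" if "t \<le> n" for t
    using assms(3-5) d_ge_2[OF that] by (auto simp: lookup_add lookup_single when_def)
  then show ?thesis
    unfolding X_power mult_single using assms coeff_nonzero[of i] coeff_nonzero[of j]
    by (intro monomial_not_killed) auto
qed

lemma parity_neq:
  assumes ij: "i \<le> n" "j \<le> n" "i \<noteq> j"
  shows "even (d i) \<noteq> even (d j)"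
proof
  assume par: "even (d i) = even (d j)"
  have d: "d i \<ge> 2" "d j \<ge> 2" using d_ge_2 ij by auto
  have Xi: "1 * X i ^ Suc (d i - 1) \<in> ci_span n d" and Xj: "1 * X j ^ Suc (d j - 1) \<in> ci_span n d"
    using d X_power_mem[OF ij(1)] X_power_mem[OF ij(2)] by (simp_all del: power_Suc)
  show False
  proof (cases "even (d i)")
    case True
    then have "even ((d i - 1) + (d j - 1) choose (d i - 1))"
      using par d by (intro even_choose_odd_odd) auto
    from J.central_binomial_mem[OF Xi Xj this] show False
      using pair_power_not_mem[OF ij] by simp
  next
    case False
    then have "even (d i - 1)" "even (d j - 1)" using par by auto
    then obtain r t where rt: "d i - 1 = 2 * r" "d j - 1 = 2 * t" by (metis evenE)
    then have d_eq: "d i = 2 * r + 1" "d j = 2 * t + 1" and pos: "r \<ge> 1" "t \<ge> 1"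
      using d by auto
    obtain q e where q: "X i + X j + q = l" "q ^ Suc e \<in> ci_span n d"
      "socle_degree = (d i - 1) + (d j - 1) + e" using pair_split[OF ij] by metis
    \<comment> \<open>Here \<open>?N + e\<close> equals \<open>socle_degree - 2\<close>, the largest
      power that \<open>X_not_killed\<close> allows for a monomial of degree one.\<close>
    let ?N = "2 * (r + t - 1)"
    have lift: "z * l ^ (?N + e) \<in> ci_span n d" if "z * (X i + X j) ^ ?N \<in> ci_span n d" for z
      using ci.binomial_mem[OF that q(2), of "?N + e"] by (simp add: q(1))
    have "X i * l ^ (?N + e) \<notin> ci_span n d" "X j * l ^ (?N + e) \<notin> ci_span n d"
      using X_not_killed[of i j 1 0 "?N + e"] X_not_killed[of i j 0 1 "?N + e"] ij pos
      by (simp_all add: q(3) d_eq)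
    moreover have "(X i + X j) ^ (2 * (r + t)) \<notin> ci_span n d"
      using pair_power_not_mem[OF ij] unfolding rt by (simp add: distrib_left)
    ultimately show False
      using J.even_even_mem[OF Xi[unfolded rt] Xj[unfolded rt] pos] lift[of "X i"] lift[of "X j"]
      by auto
  qed
qed

text \<open>Three exponents cannot have pairwise distinct parities.\<close>

lemma two_variables: "n = 1"
proof (rule ccontr)
  assume "n \<noteq> 1"
  then have "0 \<le> n" "1 \<le> n" "2 \<le> n" using n_pos by auto
  then show False
    using parity_neq[of 0 1] parity_neq[of 0 2] parity_neq[of 1 2] by simp
qed

text \<open>
  Since \<open>l\<^sup>2 = x\<^sup>2 + y\<^sup>2\<close> for \<open>l = x + y\<close>, even powers of \<open>l\<close> can be analysed in the variables
  \<open>x\<^sup>2, y\<^sup>2\<close>, where \<open>1\<close> and \<open>y\<close> generate algebras with exponents \<open>(r + 1, t + 1)\<close> and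
  \<open>(r + 1, t)\<close>. As \<open>t\<close> and \<open>t - 1\<close> have different parities, one of the two has exponents of
  equal parity.
\<close>

lemma exponents_bound:
  assumes ij: "i \<le> n" "j \<le> n" "i \<noteq> j" and di: "d i = 2 * r + 2" and dj: "d j = 2 * t + 1"
  shows "r = 0 \<or> t = 1 \<and> even r"
proof (rule ccontr)
  assume neg: "\<not> ?thesis"
  have t: "t \<ge> 1" using d_ge_2[OF ij(2)] dj by simp
  obtain q e where q: "X i + X j + q = l" "socle_degree = (d i - 1) + (d j - 1) + e" "q = 0"
    "q ^ Suc e \<in> ci_span n d" using pair_split[OF ij] two_variables by metis
  have "socle_degree = (\<Sum>i\<in>{i, j}. d i - 1)"
    unfolding socle_degree_def using ij two_variables by (intro sum.cong) auto
  then have e: "socle_degree = 2 * r + 2 * t + 1" using ij di dj by simp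
  let ?x = "X i" and ?y = "X j"
  have l2: "l ^ (2 * N) = (?x\<^sup>2 + ?y\<^sup>2) ^ N" for N
    using power_sum_char2[OF J.two_eq_zero, of ?x ?y N] q by simp
  \<comment> \<open>An instance of \<open>l2\<close> in the shape that \<open>even_even_mem\<close>
    yields when its variables are the squares of \<open>?x\<close> and \<open>?y\<close>.\<close>
  have l4: "l ^ (2 * (2 * N)) = (?x\<^sup>2 + ?y\<^sup>2) ^ (2 * N)" for N
    by (rule l2)
  have x: "1 * (?x\<^sup>2) ^ Suc r \<in> ci_span n d"
    using X_power_mem[OF ij(1)] unfolding di power_mult[symmetric] by simp
  have y: "?y * (?y\<^sup>2) ^ t \<in> ci_span n d"
    using X_power_mem[OF ij(2)] unfolding dj power_mult[symmetric] by simp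
  have yx: "?y * (?x\<^sup>2) ^ Suc r \<in> ci_span n d"
    using ci.mult_mem[OF x, of ?y] by simp
  have y': "1 * (?y\<^sup>2) ^ Suc t \<in> ci_span n d"
    using ci.mult_mem[OF y, of ?y] by (simp add: power2_eq_square mult.assoc)
  have not_killed: "?x ^ u * ?y ^ v * l ^ N \<notin> ci_span n d"
    if "u < d i" "v < d j" "2 * (u + v) + N \<le> 2 * r + 2 * t + 1" "2 * (u + v) < 2 * r + 2 * t + 1" for u v N
    using X_not_killed[OF ij that(1,2), of N] that(3,4) e by simp
  \<comment> \<open>Cases 1 and 3 take the factor 1, cases 2 and 4 the factor \<open>?y\<close>. Odd
    exponents give an even central binomial coefficient, even ones go through
    \<open>even_even_mem\<close>. The latter needs positive halves: this is where
    \<open>r = 0\<close>, and \<open>t = 1\<close> with \<open>r\<close> even, are excluded.\<close>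
  consider "odd r" "odd t" | "odd r" "even t" | "even r" "even t" | "even r" "odd t" by blast
  then show False
  proof cases
    case 1
    from J.central_binomial_mem[OF x y' even_choose_odd_odd[OF 1]]
    show False using not_killed[of 0 0 "2 * (r + t)"] di dj t unfolding l2 by simp
  next
    case 2
    then obtain t' where t': "t = Suc t'" "odd t'" using t by (cases t) auto
    from J.central_binomial_mem[OF yx y[unfolded t'] even_choose_odd_odd[OF 2(1) t'(2)]]
    show False using not_killed[of 0 1 "2 * (r + t')"] di dj t' 2 unfolding l2 by auto
  next
    case 3
    then obtain r' t' where rt: "r = 2 * r'" "t = 2 * t'" by (auto elim!: evenE)
    then have pos: "r' \<ge> 1" "t' \<ge> 1" using neg t by auto
    from J.even_even_mem[OF x[unfolded rt] y'[unfolded rt] pos] show False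
      using not_killed[of 0 0 "2 * (2 * (r' + t'))"] not_killed[of 2 0 "2 * (2 * (r' + t' - 1))"]
        not_killed[of 0 2 "2 * (2 * (r' + t' - 1))"] di dj rt pos
      unfolding l4 by simp
  next
    case 4
    then obtain r' where r: "r = 2 * r'" by (auto elim!: evenE)
    from 4 obtain t' where t': "t = Suc (2 * t')" by (auto elim!: oddE)
    have pos: "r' \<ge> 1" "t' \<ge> 1" using neg 4 r t' by auto
    have yyy: "?y * ?y\<^sup>2 = ?y ^ 3" by (simp add: power3_eq_cube power2_eq_square)
    from J.even_even_mem[OF yx[unfolded r] y[unfolded t'] pos] show False
      using not_killed[of 0 1 "2 * (2 * (r' + t'))"] not_killed[of 2 1 "2 * (2 * (r' + t' - 1))"]
        not_killed[of 0 3 "2 * (2 * (r' + t' - 1))"] di dj r t' pos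
      unfolding l4 yyy by (simp add: mult.commute[of "X j"])
  qed
qed

text \<open>\<open>exponents_bound\<close> is applied with its even exponent being
  \<open>d 0\<close> or \<open>d 1\<close>. The order of the exponents then removes
  \<open>d 0 = 2\<close> in the first case, and in the second it turns \<open>t = 1\<close> into
  \<open>d 0 = 3\<close>, \<open>d 1 = 2\<close>.\<close>

lemma exponents:
  assumes "d 0 \<ge> d 1"
  shows "odd (d 0) \<and> d 1 = 2 \<or> (\<exists>k\<ge>1. d 0 = 4 * k + 2) \<and> d 1 = 3"
proof (cases "even (d 0)")
  case True
  then have "odd (d 1)" using parity_neq[of 0 1] n_pos by simp
  then obtain t where t: "d 1 = 2 * t + 1" by (auto elim: oddE)
  obtain r where "d 0 = 2 * r" using True by (auto elim: evenE)
  then obtain r where r: "d 0 = 2 * r + 2"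
    using d_ge_2[of 0] by (cases r) auto
  have "r = 0 \<or> t = 1 \<and> even r"
    using exponents_bound[OF _ _ _ r t] n_pos by simp
  moreover have "r \<noteq> 0" using assms r t d_ge_2[of 1] n_pos by auto
  ultimately obtain k where "t = 1" "r = 2 * k" "k \<ge> 1" by (auto elim!: evenE)
  then show ?thesis using r t by auto
next
  case False
  then have "even (d 1)" using parity_neq[of 0 1] n_pos by simp
  then obtain r where "d 1 = 2 * r" by (auto elim: evenE)
  then obtain r where r: "d 1 = 2 * r + 2"
    using d_ge_2[of 1] n_pos by (cases r) auto
  obtain t where t: "d 0 = 2 * t + 1" using False by (auto elim: oddE)
  have "r = 0 \<or> t = 1 \<and> even r"
    using exponents_bound[OF _ _ _ r t] n_pos by simp
  then show ?thesis using assms r t False by auto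
qed

end

section \<open>Sufficient conditions\<close>

declare One_nat_def [simp del]

section \<open>Terms in two variables and congruences modulo an ideal\<close>

definition bimon :: "nat \<Rightarrow> nat \<Rightarrow> 'k::field \<Rightarrow> 'k mpoly" where
  "bimon u v a = Poly_Mapping.single (Poly_Mapping.single 0 u + Poly_Mapping.single 1 v) a"

lemma bimon_mult: "bimon u v a * bimon u' v' b = bimon (u + u') (v + v') (a * b)"
proof -
  have "Poly_Mapping.single 0 u + Poly_Mapping.single 1 v
      + (Poly_Mapping.single 0 u' + Poly_Mapping.single 1 v') =
    (Poly_Mapping.single 0 (u + u') + Poly_Mapping.single 1 (v + v') :: monomial)"
    by (simp add: single_add algebra_simps)
  then show ?thesis by (simp add: bimon_def mult_single)
qed

lemma bimon_power: "bimon u v a ^ k = bimon (k * u) (k * v) (a ^ k)"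
  by (induction k) (simp_all add: bimon_mult, simp add: bimon_def)

lemma bimon_add: "bimon u v a + bimon u v b = bimon u v (a + b)"
  by (simp add: bimon_def single_add)

lemma bimon_mem_forms: "u + v = s \<Longrightarrow> bimon u v a \<in> forms {..1} s"
  unfolding bimon_def by (rule forms_single) auto

lemma bimon_mem_iff: "bimon u v a \<in> ci_span 1 d \<longleftrightarrow> a = 0 \<or> d 0 \<le> u \<or> d 1 \<le> v"
proof -
  have "(\<exists>i\<le>1. P i) \<longleftrightarrow> P 0 \<or> P (1::nat)" for P
    by (auto simp: le_Suc_eq One_nat_def)
  then show ?thesis
    unfolding bimon_def single_mem_ci_span_iff by (simp add: lookup_add lookup_single)
qed

lemma single_eq_bimon:
  assumes "Poly_Mapping.keys m \<subseteq> {..1}"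
  shows "Poly_Mapping.single m a = bimon (Poly_Mapping.lookup m 0) (Poly_Mapping.lookup m 1) a"
proof -
  have "m = Poly_Mapping.single 0 (Poly_Mapping.lookup m 0) + Poly_Mapping.single 1 (Poly_Mapping.lookup m 1)"
  proof (intro poly_mapping_eqI)
    fix i
    have "i \<notin> {..1} \<Longrightarrow> Poly_Mapping.lookup m i = 0"
      using assms by (auto simp: in_keys_iff subset_iff)
    then show "Poly_Mapping.lookup m i = Poly_Mapping.lookup
      (Poly_Mapping.single 0 (Poly_Mapping.lookup m 0) + Poly_Mapping.single 1 (Poly_Mapping.lookup m 1)) i"
      by (cases "i = 0"; cases "i = 1") (auto simp: lookup_add lookup_single)
  qed
  then show ?thesis unfolding bimon_def by simp
qed

lemma (in type_ideal) mem_cong: "x - y \<in> J \<Longrightarrow> x \<in> J \<longleftrightarrow> y \<in> J"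
  using add_mem[of "x - y" y] diff_mem[of x "x - y"] by auto

lemma (in type_ideal) add_mem_iff: "x \<in> J \<Longrightarrow> x + y \<in> J \<longleftrightarrow> y \<in> J"
  by (rule mem_cong) simp

text \<open>The difference of the two powers is divisible by \<open>z\<close>.\<close>

lemma (in type_ideal) power_add_cong:
  assumes "z \<in> J"
  shows "(w + z) ^ k - w ^ k \<in> J"
proof -
  have "(w + z) ^ k - w ^ k = z * (\<Sum>i<k. w ^ (k - Suc i) * (w + z) ^ i)"
    using power_diff_sumr2[of "w + z" k w] by simp
  then show ?thesis using mult_mem_right[OF assms] by simp
qed

text \<open>The parameter \<open>k_type\<close> only fixes the coefficient field, since the type of
  \<open>d\<close> does not mention it.\<close>

locale bivariate_char2 =
  fixes d :: "nat \<Rightarrow> nat" and k_type :: "'k::field itself"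
  assumes char2: "(2 :: 'k) = 0"
begin

abbreviation J :: "'k mpoly set" where "J \<equiv> ci_span 1 d"

definition l :: "'k mpoly" where "l = bimon 1 0 1 + bimon 0 1 1"

lemma l_mem_forms: "l \<in> forms {..1} 1"
  unfolding l_def by (intro forms_add bimon_mem_forms) auto

lemma l_power_even: "l ^ (2 * N) = (bimon 2 0 1 + bimon 0 2 1) ^ N"
  unfolding l_def power_sum_char2[OF two_eq_zero_mpoly[OF char2]] by (simp add: bimon_power)

text \<open>Surjectivity of multiplication by \<open>l ^ k\<close> from degree \<open>s\<close>
  becomes the inclusion of \<open>forms {..1} (s + k)\<close> in this set.\<close>

definition image_mod :: "nat \<Rightarrow> nat \<Rightarrow> 'k mpoly set" where
  "image_mod s k = {g. \<exists>f\<in>forms {..1} s. l ^ k * f - g \<in> J}"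

lemma image_modI: "f \<in> forms {..1} s \<Longrightarrow> l ^ k * f - g \<in> J \<Longrightarrow> g \<in> image_mod s k"
  unfolding image_mod_def by blast

lemma ideal_image_mod: "g \<in> J \<Longrightarrow> g \<in> image_mod s k"
  by (rule image_modI[of 0]) (simp_all add: ci.uminus_mem)

lemma add_image_mod:
  assumes "g \<in> image_mod s k" "h \<in> image_mod s k"
  shows "g + h \<in> image_mod s k"
proof -
  obtain f f' where f: "f \<in> forms {..1} s" "l ^ k * f - g \<in> J" "f' \<in> forms {..1} s" "l ^ k * f' - h \<in> J"
    using assms unfolding image_mod_def by blast
  have "l ^ k * (f + f') - (g + h) = (l ^ k * f - g) + (l ^ k * f' - h)"
    by (simp add: algebra_simps)
  then show ?thesis
    using ci.add_mem[OF f(2,4)] by (intro image_modI[OF forms_add[OF f(1,3)]]) (simp only:)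
qed

text \<open>The image is closed under addition and contains \<open>J\<close>, so only the terms that
  survive modulo \<open>J\<close> have to be reached.\<close>

lemma forms_subset_image_mod:
  assumes "\<And>u v a. u + v = t \<Longrightarrow> u < d 0 \<Longrightarrow> v < d 1 \<Longrightarrow> bimon u v a \<in> image_mod s k"
  shows "forms {..1} t \<subseteq> image_mod s k"
proof
  fix g :: "'k mpoly" assume g: "g \<in> forms {..1} t"
  have bimon: "Poly_Mapping.single m a \<in> image_mod s k" if m: "m \<in> Poly_Mapping.keys g" for m a
  proof -
    let ?u = "Poly_Mapping.lookup m 0" and ?v = "Poly_Mapping.lookup m 1"
    have keys: "Poly_Mapping.keys m \<subseteq> {..1}" and "mdeg m = t" using g m by (auto simp: forms_def)
    then have "?u + ?v = t" using mdeg_eq_sum[OF _ keys] by (simp add: One_nat_def)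
    then show ?thesis
      unfolding single_eq_bimon[OF keys]
      using assms ideal_image_mod[of "bimon ?u ?v a"] by (cases "d 0 \<le> ?u \<or> d 1 \<le> ?v") (auto simp: bimon_mem_iff)
  qed
  have "sum f T \<in> image_mod s k" if "\<And>x. x \<in> T \<Longrightarrow> f x \<in> image_mod s k"
    for f :: "monomial \<Rightarrow> 'k mpoly" and T
    using that by (induction T rule: infinite_finite_induct) (auto intro: add_image_mod ideal_image_mod)
  from this[of "Poly_Mapping.keys g", OF bimon] show "g \<in> image_mod s k"
    by (subst sum_single_keys[symmetric])
qed

text \<open>
  Modulo the image of \<open>l = x + y\<close>, a monomial can be rewritten by trading a factor \<open>x\<close> for \<open>y\<close>,
  until the power of \<open>y\<close> vanishes.
\<close>

lemma image_mod_one: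
  assumes s: "d 1 \<le> Suc s"
  shows "forms {..1} (Suc s) \<subseteq> image_mod s 1"
proof (rule forms_subset_image_mod)
  have "bimon u v a \<in> image_mod s 1" if "u + v = Suc s" for u v and a :: 'k
    using that
  proof (induction "d 1 - v" arbitrary: u v)
    case 0
    then show ?case by (intro ideal_image_mod) (simp add: bimon_mem_iff)
  next
    case (Suc w)
    \<comment> \<open>In this case \<open>v < d 1\<close>, and \<open>d 1\<close> is at most
      \<open>Suc s = u + v\<close>, so a factor x is left to trade.\<close>
    then obtain u' where u: "u = Suc u'" using s by (cases u) auto
    have "bimon u' (Suc v) a \<in> image_mod s 1"
      using Suc u by (intro Suc.hyps(1)) auto
    then obtain f where f: "f \<in> forms {..1} s" "l * f - bimon u' (Suc v) a \<in> J"
      unfolding image_mod_def by auto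
    have "l ^ 1 * (bimon u' v a - f) - bimon u v a = - (l * f - bimon u' (Suc v) a)"
      by (simp add: l_def u algebra_simps bimon_mult plus_1_eq_Suc)
    then show ?case
      using Suc.prems u ci.uminus_mem[OF f(2)]
      by (intro image_modI[of "bimon u' v a - f"] forms_diff bimon_mem_forms f) auto
  qed
  then show "bimon u v a \<in> image_mod s 1" if "u + v = Suc s" for u v and a :: 'k
    using that by blast
qed

text \<open>Composes the surjections by \<open>l\<close> in the degrees \<open>s\<close>, ...,
  \<open>s + k - 1\<close>, all of which satisfy the bound of \<open>image_mod_one\<close>.\<close>

lemma image_mod_power:
  assumes s: "d 1 \<le> Suc s"
  shows "forms {..1} (s + k) \<subseteq> image_mod s k"
proof (induction k)
  case 0
  show ?case by (auto intro!: image_modI)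
next
  case (Suc k)
  show ?case
  proof
    fix g :: "'k mpoly" assume "g \<in> forms {..1} (s + Suc k)"
    then have "g \<in> image_mod (s + k) 1"
      using image_mod_one[of "s + k"] s by auto
    then obtain f where f: "f \<in> forms {..1} (s + k)" "l * f - g \<in> J"
      unfolding image_mod_def by auto
    then obtain h where h: "h \<in> forms {..1} s" "l ^ k * h - f \<in> J"
      using Suc unfolding image_mod_def by blast
    have "l ^ Suc k * h - g = l * (l ^ k * h - f) + (l * f - g)"
      by (simp add: algebra_simps)
    then show "g \<in> image_mod s (Suc k)"
      using ci.add_mem[OF ci.mult_mem[OF h(2)] f(2)] by (intro image_modI[OF h(1)]) (simp only:)
  qed
qed

lemma image_mod_beyond_socle:
  assumes "(d 0 - 1) + (d 1 - 1) < t"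
  shows "forms {..1} t \<subseteq> image_mod s k"
proof
  fix g :: "'k mpoly" assume "g \<in> forms {..1} t"
  then show "g \<in> image_mod s k"
    using assms by (intro ideal_image_mod forms_mem_ci_span[of "{..1}" 1 d t]) (auto simp: One_nat_def)
qed

lemma mult_power_mem_mono: "l ^ k * f \<in> J \<Longrightarrow> k \<le> k' \<Longrightarrow> l ^ k' * f \<in> J"
  using ci.mult_power_mono[of f l k] by (simp add: mult.commute)

text \<open>Negative degrees have zero source, degrees from \<open>d 1 - 1\<close> on give
  surjections by \<open>image_mod_power\<close>, and targets beyond the socle degree are zero. Only
  the listed cases remain.\<close>

lemma strong_lefschetzI:
  assumes "\<And>s k. k \<ge> 1 \<Longrightarrow> Suc s < d 1 \<Longrightarrow> s + k \<le> (d 0 - 1) + (d 1 - 1) \<Longrightarrow>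
    (\<forall>f\<in>forms {..1} s. l ^ k * f \<in> J \<longrightarrow> f \<in> J) \<or> forms {..1} (s + k) \<subseteq> image_mod s k"
  shows "strong_lefschetz 1 (monomial_ci 1 d :: 'k mpoly set)"
  unfolding strong_lefschetz_iff
proof (intro bexI allI impI)
  fix e :: int and k :: nat assume k: "k \<ge> 1"
  show "(\<forall>f\<in>homogeneous_part 1 e. l ^ k * f \<in> J \<longrightarrow> f \<in> J) \<or>
    (\<forall>g\<in>homogeneous_part 1 (e + int k). \<exists>f\<in>homogeneous_part 1 e. l ^ k * f - g \<in> J)"
  proof (cases "e < 0")
    case True
    then show ?thesis by (simp add: homogeneous_part_neg)
  next
    case False
    then obtain s where e: "e = int s" using nonneg_int_cases by (metis not_less)
    have "(\<forall>f\<in>forms {..1} s. l ^ k * f \<in> J \<longrightarrow> f \<in> J) \<or> forms {..1} (s + k) \<subseteq> image_mod s k"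
      using assms[OF k, of s] image_mod_power[of s k] image_mod_beyond_socle[of "s + k" s k] by linarith
    then show ?thesis
      unfolding e of_nat_add[symmetric] homogeneous_part_int image_mod_def by blast
  qed
qed (simp add: homogeneous_part_one l_mem_forms)

section \<open>Low degrees and the two families of exponents\<close>

lemma forms_zero_eq: "f \<in> forms {..1} 0 \<Longrightarrow> \<exists>a. f = bimon 0 0 a"
proof -
  assume f: "f \<in> forms {..1} 0"
  have "Poly_Mapping.lookup f m = 0" if "m \<noteq> 0" for m
  proof (rule ccontr)
    assume "Poly_Mapping.lookup f m \<noteq> 0"
    then have "mdeg m = 0" using f by (auto simp: forms_def in_keys_iff)
    then have "m = 0"
      by (intro poly_mapping_eqI) (auto simp: mdeg_def in_keys_iff)
    then show False using that by simp
  qed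
  then have "f = bimon 0 0 (Poly_Mapping.lookup f 0)"
    by (intro poly_mapping_eqI) (auto simp: bimon_def lookup_single when_def)
  then show ?thesis by blast
qed

lemma forms_one_eq:
  assumes "f \<in> forms {..1} 1"
  shows "\<exists>a b. f = bimon 1 0 a + bimon 0 1 (b :: 'k)"
proof -
  have "f = bimon 1 0 (Poly_Mapping.lookup f (Poly_Mapping.single 0 1))
      + bimon 0 1 (Poly_Mapping.lookup f (Poly_Mapping.single 1 1))"
    using linear_form_eq_sum[OF assms] by (simp add: bimon_def One_nat_def)
  then show ?thesis by blast
qed

lemma power_mult_cong:
  assumes "l ^ m - w \<in> J"
  shows "l ^ (m + k) * f \<in> J \<longleftrightarrow> w * (l ^ k * f) \<in> J"
proof (rule ci.mem_cong)
  show "l ^ (m + k) * f - w * (l ^ k * f) \<in> J"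
    using ci.mult_mem_right[OF assms, of "l ^ k * f"] by (simp add: power_add algebra_simps)
qed

text \<open>Only constants have to be checked. As y^2 vanishes, l^(2r) is congruent to x^(2r), hence
  l^(2r+1) to the socle monomial x^(2r) y. No smaller power can kill a nonzero constant.\<close>

lemma strong_lefschetz_two:
  assumes d: "odd (d 0)" "d 1 = 2"
  shows "strong_lefschetz 1 (monomial_ci 1 d :: 'k mpoly set)"
proof (rule strong_lefschetzI)
  fix s k assume sk: "Suc s < d 1" "s + k \<le> (d 0 - 1) + (d 1 - 1)"
  obtain r where r: "d 0 = 2 * r + 1" using d(1) by (auto elim: oddE)
  have "bimon 0 2 1 \<in> J" by (simp add: bimon_mem_iff d)
  from ci.power_add_cong[OF this, of "bimon 2 0 1" r]
  have l: "l ^ (2 * r) - bimon (2 * r) 0 1 \<in> J"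
    unfolding l_power_even by (simp add: bimon_power mult.commute)
  have "f \<in> J" if f: "f \<in> forms {..1} s" "l ^ k * f \<in> J" for f
  proof -
    obtain a where a: "f = bimon 0 0 a" using f(1) forms_zero_eq sk d by auto
    have "l ^ (2 * r + 1) * bimon 0 0 a \<in> J"
      using mult_power_mem_mono[OF f(2), of "2 * r + 1"] sk d r a by simp
    then have "bimon (2 * r) 0 1 * (l ^ 1 * bimon 0 0 a) \<in> J"
      unfolding power_mult_cong[OF l] .
    also have "bimon (2 * r) 0 1 * (l ^ 1 * bimon 0 0 a) = bimon (2 * r + 1) 0 a + bimon (2 * r) 1 a"
      by (simp add: l_def distrib_left distrib_right bimon_mult)
    finally have "bimon (2 * r) 1 a \<in> J"
      by (subst (asm) ci.add_mem_iff) (simp_all add: bimon_mem_iff r)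
    then show ?thesis using a by (simp add: bimon_mem_iff r d)
  qed
  then show "(\<forall>f\<in>forms {..1} s. l ^ k * f \<in> J \<longrightarrow> f \<in> J) \<or> forms {..1} (s + k) \<subseteq> image_mod s k"
    by blast
qed

text \<open>As y^4 vanishes, l^(4r) is congruent to x^(4r), which reduces everything to powers of l
  up to the third. Degrees 0 and 1 remain. From degree 1 the map is injective except when it hits
  the socle degree 4r+3, where it is surjective.\<close>

lemma strong_lefschetz_three:
  assumes d: "d 0 = 4 * r + 2" "d 1 = 3"
  shows "strong_lefschetz 1 (monomial_ci 1 d :: 'k mpoly set)"
proof (rule strong_lefschetzI)
  fix s k assume sk: "Suc s < d 1" "s + k \<le> (d 0 - 1) + (d 1 - 1)"
  have "bimon 0 4 1 \<in> J" by (simp add: bimon_mem_iff d)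
  from ci.power_add_cong[OF this, of "bimon 4 0 1" r]
  have "(bimon 4 0 1 + bimon 0 4 1) ^ r - bimon (4 * r) 0 1 \<in> J"
    by (simp add: bimon_power mult.commute)
  moreover have "l ^ (4 * r) = (bimon 4 0 1 + bimon 0 4 1) ^ r"
    using l_power_even[of "2 * r"] power_sum_char2[OF two_eq_zero_mpoly[OF char2], of "bimon 2 0 1" "bimon 0 2 1" r]
    by (simp add: bimon_power)
  ultimately have l: "l ^ (4 * r) - bimon (4 * r) 0 1 \<in> J" by simp
  have l2: "l ^ 2 = bimon 2 0 1 + bimon 0 2 1"
    using l_power_even[of 1] by simp
  consider "s = 0" | "s = 1" "k \<le> 4 * r + 1" | "s = 1" "k = 4 * r + 2"
    using sk d by linarith
  then show "(\<forall>f\<in>forms {..1} s. l ^ k * f \<in> J \<longrightarrow> f \<in> J) \<or> forms {..1} (s + k) \<subseteq> image_mod s k"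
  proof cases
    case 1
    have "f \<in> J" if f: "f \<in> forms {..1} s" "l ^ k * f \<in> J" for f
    proof -
      obtain a where a: "f = bimon 0 0 a" using f(1) forms_zero_eq 1 by auto
      have "l ^ (4 * r + 3) * bimon 0 0 a \<in> J"
        using mult_power_mem_mono[OF f(2), of "4 * r + 3"] sk d a by simp
      then have "bimon (4 * r) 0 1 * (l ^ 3 * bimon 0 0 a) \<in> J"
        unfolding power_mult_cong[OF l] .
      also have "l ^ 3 = l ^ 2 * l" by (simp add: power3_eq_cube power2_eq_square)
      \<comment> \<open>Of the four terms only x^(4r+1) y^2, the socle monomial, is nonzero modulo
        \<open>J\<close>.\<close>
      also have "bimon (4 * r) 0 1 * (l ^ 2 * l * bimon 0 0 a) = bimon (4 * r + 3) 0 a +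
          (bimon (4 * r) 3 a + (bimon (4 * r + 2) 1 a + bimon (4 * r + 1) 2 a))"
        unfolding l2 by (simp add: l_def distrib_left distrib_right bimon_mult numeral_2_eq_2 numeral_3_eq_3)
      finally have "bimon (4 * r + 1) 2 a \<in> J"
        by (simp add: ci.add_mem_iff bimon_mem_iff d)
      then show ?thesis using a by (simp add: bimon_mem_iff d)
    qed
    then show ?thesis by blast
  next
    case 2
    have "f \<in> J" if f: "f \<in> forms {..1} s" "l ^ k * f \<in> J" for f
    proof -
      obtain a b where ab: "f = bimon 1 0 a + bimon 0 1 b" using forms_one_eq[of f] f(1) 2 by blast
      have "l ^ (4 * r + 1) * f \<in> J"
        using mult_power_mem_mono[OF f(2), of "4 * r + 1"] 2 by simp
      then have "bimon (4 * r) 0 1 * (l ^ 1 * f) \<in> J"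
        unfolding power_mult_cong[OF l] .
      also have "bimon (4 * r) 0 1 * (l ^ 1 * f) =
        bimon (4 * r + 2) 0 a + (bimon (4 * r) 2 b + bimon (4 * r + 1) 1 (a + b))"
        by (simp add: ab l_def distrib_left distrib_right bimon_mult numeral_2_eq_2 flip: bimon_add)
      finally have *: "bimon (4 * r) 2 b + bimon (4 * r + 1) 1 (a + b) \<in> J"
        by (simp add: ci.add_mem_iff bimon_mem_iff d)
      \<comment> \<open>Multiplying by y kills the first term and isolates the coefficient
        \<open>a + b\<close>.\<close>
      have "bimon (4 * r) 3 b + bimon (4 * r + 1) 2 (a + b) \<in> J"
        using ci.mult_mem[OF *, of "bimon 0 1 1"] by (simp add: distrib_left bimon_mult)
      then have "a + b = 0" by (simp add: ci.add_mem_iff bimon_mem_iff d)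
      then have "bimon (4 * r) 2 b \<in> J" using * by (simp add: bimon_def)
      then have "b = 0" by (simp add: bimon_mem_iff d)
      then show ?thesis using ab \<open>a + b = 0\<close> by (simp add: bimon_def)
    qed
    then show ?thesis by blast
  next
    case 3
    have "forms {..1} (s + k) \<subseteq> image_mod s k"
    proof (rule forms_subset_image_mod)
      fix u v and a :: 'k assume "u + v = s + k" "u < d 0" "v < d 1"
      then have uv: "u = 4 * r + 1" "v = 2" using 3 d by auto
      have lk: "l ^ k = l ^ (4 * r) * (bimon 2 0 1 + bimon 0 2 1)"
        unfolding 3(2) power_add l2 by (rule refl)
      \<comment> \<open>The preimage is a multiple of x: modulo \<open>J\<close>, l^(4r+2) x becomes
        x^(4r) (x^3 + x y^2), where x^(4r+3) vanishes and the socle monomial is left.\<close>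
      have "(l ^ (4 * r) - bimon (4 * r) 0 1) * (l ^ 2 * bimon 1 0 a) + bimon (4 * r + 3) 0 a \<in> J"
        by (intro ci.add_mem ci.mult_mem_right[OF l]) (simp add: bimon_mem_iff d)
      also have "(l ^ (4 * r) - bimon (4 * r) 0 1) * (l ^ 2 * bimon 1 0 a) + bimon (4 * r + 3) 0 a =
        l ^ k * bimon 1 0 a - bimon u v a"
        unfolding lk l2 uv
        by (simp add: distrib_left distrib_right left_diff_distrib bimon_mult mult.assoc
            numeral_2_eq_2 numeral_3_eq_3)
      finally show "bimon u v a \<in> image_mod s k"
        by (intro image_modI[of "bimon 1 0 a"]) (simp_all add: bimon_mem_forms 3)
    qed
    then show ?thesis by blast
  qed
qed

end

theorem theorem7p1:
  fixes n :: nat and d :: "nat \<Rightarrow> nat"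
  assumes "n \<ge> 1"
    and "\<forall>i<n. d i \<ge> d (Suc i)"
    and "d n \<ge> 2"
    and "infinite (UNIV :: 'k::field set)"
    and "CHAR('k) = 2"
  shows "strong_lefschetz n (monomial_ci n d :: 'k mpoly set) \<longleftrightarrow>
    n = 1 \<and> (odd (d 0) \<and> d 1 = 2 \<or> (\<exists>k::nat. k \<ge> 1 \<and> d 0 = 4 * k + 2) \<and> d 1 = 3)"
proof
  have char2: "(2 :: 'k) = 0"
    using of_nat_CHAR[where ?'a = 'k] assms(5) by simp
  show "n = 1 \<and> (odd (d 0) \<and> d 1 = 2 \<or> (\<exists>k::nat. k \<ge> 1 \<and> d 0 = 4 * k + 2) \<and> d 1 = 3)"
    if slp: "strong_lefschetz n (monomial_ci n d :: 'k mpoly set)"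
  proof -
    have d_ge_2: "d i \<ge> 2" if "i \<le> n" for i
      using that by (induction rule: inc_induct) (use assms(2,3) le_trans in blast)+
    from slp obtain l :: "'k mpoly" where l: "l \<in> homogeneous_part n 1"
      "\<And>e k. k \<ge> 1 \<Longrightarrow>
        (\<forall>f\<in>homogeneous_part n e. l ^ k * f \<in> ci_span n d \<longrightarrow> f \<in> ci_span n d) \<or>
        (\<forall>g\<in>homogeneous_part n (e + int k). \<exists>f\<in>homogeneous_part n e. l ^ k * f - g \<in> ci_span n d)"
      unfolding strong_lefschetz_iff by blast
    interpret lefschetz_char2 n d l
      using l assms(1) d_ge_2 char2 by unfold_locales (auto simp: homogeneous_part_one)
    show ?thesis
      using two_variables exponents assms(2) by (auto simp: One_nat_def)
  qed
  interpret bivariate_char2 d "TYPE('k)"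
    by unfold_locales (rule char2)
  show "strong_lefschetz n (monomial_ci n d :: 'k mpoly set)"
    if "n = 1 \<and> (odd (d 0) \<and> d 1 = 2 \<or> (\<exists>k::nat. k \<ge> 1 \<and> d 0 = 4 * k + 2) \<and> d 1 = 3)"
    using that strong_lefschetz_two strong_lefschetz_three by auto
qed

end
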